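(* Let $G$ be a finite simple connected graph with at least $3$ vertices (so that $G$ has at least one non-pendant vertex), with $m$ edges and maximum degree $\Delta$. Let $p$ be the number of pendant vertices of $G$ and let $\delta_1$ be the minimum degree among the non-pendant vertices of $G$. Then $$DSO(G) \le p\,\frac{\sqrt{\Delta^2+1}}{\Delta+1} + (m-p)\,\frac{\sqrt{\Delta^2+\delta_1^2}}{\Delta+\delta_1}.$$ Equality holds if and only if every edge incident to a pendant vertex has its other endpoint of degree $\Delta$, and every edge between two non-pendant vertices joins a vertex of degree $\Delta$ to a vertex of degree $\delta_1$.
   Context: For a finite simple graph $G=(V(G),E(G))$, $d_u$ denotes the degree of the vertex $u$. A pendant vertex is a vertex of degree $1$; a non-pendant vertex is one that is not pendant. The Diminished Sombor index is $DSO(G)=\sum_{uv\in E(G)}\frac{\sqrt{d_u^2+d_v^2}}{d_u+d_v}$. *)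

theory Defs
  imports Complex_Main
begin

definition simple_graph :: "'a set \<Rightarrow> 'a set set \<Rightarrow> bool" where
  "simple_graph V E \<longleftrightarrow> finite V \<and> (\<forall>e\<in>E. e \<subseteq> V \<and> card e = 2)"

definition connected_graph :: "'a set \<Rightarrow> 'a set set \<Rightarrow> bool" where
  "connected_graph V E \<longleftrightarrow> V \<noteq> {} \<and> (\<forall>u\<in>V. \<forall>v\<in>V. (u, v) \<in> {(x, y). {x, y} \<in> E}\<^sup>*)"

definition degree :: "'a set set \<Rightarrow> 'a \<Rightarrow> nat" where
  "degree E v = card {e \<in> E. v \<in> e}"

definition max_degree :: "'a set \<Rightarrow> 'a set set \<Rightarrow> nat" where
  "max_degree V E = Max (degree E ` V)"

definition pendant_vertices :: "'a set \<Rightarrow> 'a set set \<Rightarrow> 'a set" where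
  "pendant_vertices V E = {v \<in> V. degree E v = 1}"

definition min_nonpendant_degree :: "'a set \<Rightarrow> 'a set set \<Rightarrow> nat" where
  "min_nonpendant_degree V E = Min (degree E ` (V - pendant_vertices V E))"

text \<open>An edge is an unordered pair, so the two symmetric expressions in the endpoint degrees are
  written as sums over the two elements of the edge; \<open>DSO_summand\<close> gives the usual form.\<close>

definition DSO :: "'a set set \<Rightarrow> real" where
  "DSO E = (\<Sum>e\<in>E. sqrt (\<Sum>v\<in>e. (real (degree E v))\<^sup>2) / (\<Sum>v\<in>e. real (degree E v)))"

lemma DSO_summand:
  assumes "u \<noteq> v"
  shows "sqrt (\<Sum>w\<in>{u, v}. (real (degree E w))\<^sup>2) / (\<Sum>w\<in>{u, v}. real (degree E w)) =
    sqrt ((real (degree E u))\<^sup>2 + (real (degree E v))\<^sup>2) / (real (degree E u) + real (degree E v))"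
  using assms by simp

end

theory Submission
  imports Defs
begin

text \<open>
  With \<open>f(x, y) = sqrt (x\<^sup>2 + y\<^sup>2) / (x + y)\<close>, the index sums \<open>f\<close> of the endpoint degrees over
  the edges. For positive arguments the value \<open>f(x, y)\<close> depends only on the ratio of its arguments and grows as they move
  apart, so among pairs in an interval \<open>[a, b]\<close> it is largest exactly at the endpoints
  (\<open>sombor_ratio_le\<close>, \<open>sombor_ratio_eq_iff\<close>). For an edge between non-pendant vertices the interval
  is \<open>[\<delta>\<^sub>1, \<Delta>]\<close>; for an edge at a pendant vertex it is \<open>[1, \<Delta>]\<close>, one degree being \<open>1\<close> already.

  The edges of the second kind are exactly \<open>p\<close> in number: a pendant vertex lies on a single edge, and
  no edge has two pendant ends, because such an edge would be a whole connected component and leave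
  no room for a third vertex (\<open>no_edge_joins_pendants\<close>, \<open>card_pendant_edges\<close>). Summing the edgewise
  bounds gives the inequality, and a sum of such bounds is attained only if each of them is.
\<close>

section \<open>The summand as a function of two degrees\<close>

definition sombor_ratio :: "real \<Rightarrow> real \<Rightarrow> real" where
  "sombor_ratio x y = sqrt (x\<^sup>2 + y\<^sup>2) / (x + y)"

lemma sombor_ratio_commute: "sombor_ratio x y = sombor_ratio y x"
  by (simp add: sombor_ratio_def add.commute)

text \<open>The squares of the two ratios, brought to a common denominator, differ by a product whose
  factors compare \<open>x / y\<close> with \<open>a / b\<close> and with \<open>b / a\<close>. Both the bound and its equality case
  can be read off from the signs of these factors.\<close>

lemma sombor_ratio_square_diff:
  assumes "x + y > 0" "a + b > 0"
  shows "(sombor_ratio b a)\<^sup>2 - (sombor_ratio x y)\<^sup>2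
    = 2 * (x * b - y * a) * (y * b - x * a) / ((x + y)\<^sup>2 * (a + b)\<^sup>2)"
proof -
  have "(sombor_ratio b a)\<^sup>2 - (sombor_ratio x y)\<^sup>2
      = (b\<^sup>2 + a\<^sup>2) / (a + b)\<^sup>2 - (x\<^sup>2 + y\<^sup>2) / (x + y)\<^sup>2"
    by (simp add: sombor_ratio_def power_divide add.commute)
  also have "\<dots> = ((b\<^sup>2 + a\<^sup>2) * (x + y)\<^sup>2 - (x\<^sup>2 + y\<^sup>2) * (a + b)\<^sup>2) / ((a + b)\<^sup>2 * (x + y)\<^sup>2)"
    using assms by (intro diff_frac_eq) auto
  also have "(b\<^sup>2 + a\<^sup>2) * (x + y)\<^sup>2 - (x\<^sup>2 + y\<^sup>2) * (a + b)\<^sup>2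
      = 2 * (x * b - y * a) * (y * b - x * a)"
    by algebra
  finally show ?thesis
    by (simp add: mult.commute)
qed

lemma sombor_ratio_le:
  assumes "0 \<le> a" "a \<le> x" "x \<le> b" "a \<le> y" "y \<le> b" "0 < x" "0 < y"
  shows "sombor_ratio x y \<le> sombor_ratio b a"
proof -
  have "y * a \<le> x * b" "x * a \<le> y * b"
    using assms mult_mono[of a x y b] mult_mono[of a y x b] by (simp_all add: mult.commute)
  then have "0 \<le> (sombor_ratio b a)\<^sup>2 - (sombor_ratio x y)\<^sup>2"
    using assms by (subst sombor_ratio_square_diff) auto
  moreover have "0 \<le> sombor_ratio b a"
    using assms by (simp add: sombor_ratio_def)
  ultimately show ?thesis
    by (auto intro: power2_le_imp_le)
qed

text \<open>The gap \<open>x * b - y * a\<close> is \<open>(x - a) * b + a * (b - y)\<close>, two nonnegative terms that vanish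
  together; positivity of \<open>x\<close> and \<open>y\<close> then rules out \<open>b = 0\<close> and, once \<open>x = a\<close>, also \<open>a = 0\<close>.\<close>

lemma eq_corner_if_cross_product_eq:
  fixes a b x y :: real
  assumes "0 \<le> a" "a \<le> x" "y \<le> b" "0 < x" "0 < y" "x * b = y * a"
  shows "x = a \<and> y = b"
proof -
  have "(x - a) * b + a * (b - y) = 0"
    using assms by (simp add: algebra_simps)
  moreover have "0 \<le> (x - a) * b" "0 \<le> a * (b - y)"
    using assms by auto
  ultimately have "(x - a) * b = 0" "a * (b - y) = 0"
    by linarith+
  then show ?thesis
    using assms by auto
qed

lemma sombor_ratio_eq_iff:
  assumes "0 \<le> a" "a \<le> x" "x \<le> b" "a \<le> y" "y \<le> b" "0 < x" "0 < y"
  shows "sombor_ratio x y = sombor_ratio b a \<longleftrightarrow> (x = b \<and> y = a) \<or> (x = a \<and> y = b)"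
proof
  assume "sombor_ratio x y = sombor_ratio b a"
  then have "2 * (x * b - y * a) * (y * b - x * a) / ((x + y)\<^sup>2 * (a + b)\<^sup>2) = 0"
    using assms by (subst sombor_ratio_square_diff[symmetric]) auto
  then have "x * b = y * a \<or> y * b = x * a"
    using assms by simp
  then show "(x = b \<and> y = a) \<or> (x = a \<and> y = b)"
    using eq_corner_if_cross_product_eq[of a x y b] eq_corner_if_cross_product_eq[of a y x b] assms
    by blast
qed (auto simp: sombor_ratio_commute)

section \<open>Degrees and pendant edges\<close>

lemma simple_graph_finite_edges:
  assumes "simple_graph V E"
  shows "finite E"
  using assms by (auto simp: simple_graph_def intro: finite_subset[of E "Pow V"])

lemma simple_graph_edgeE:
  assumes "simple_graph V E" "e \<in> E"
  obtains u v where "e = {u, v}" "u \<noteq> v" "u \<in> V" "v \<in> V"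
proof -
  have "card e = 2" and sub: "e \<subseteq> V"
    using assms by (simp_all add: simple_graph_def)
  then obtain u v where "e = {u, v}" "u \<noteq> v"
    by (auto simp only: card_2_iff)
  then show thesis
    using that sub by simp
qed

lemma simple_graph_edgeD:
  assumes "simple_graph V E" "{u, v} \<in> E"
  shows "u \<in> V" "v \<in> V" "u \<noteq> v"
  using assms by (auto simp: simple_graph_def)

lemma degree_pos:
  assumes "simple_graph V E" "e \<in> E" "v \<in> e"
  shows "0 < degree E v"
  using assms simple_graph_finite_edges[OF assms(1)] by (auto simp: degree_def card_gt_0_iff)

lemma degree_le_max_degree:
  assumes "simple_graph V E" "v \<in> V"
  shows "degree E v \<le> max_degree V E"
  using assms by (simp add: max_degree_def simple_graph_def)

lemma min_nonpendant_degree_le: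
  assumes "simple_graph V E" "v \<in> V" "v \<notin> pendant_vertices V E"
  shows "min_nonpendant_degree V E \<le> degree E v"
  using assms by (simp add: min_nonpendant_degree_def simple_graph_def)

lemma pendant_edge_unique:
  assumes "v \<in> pendant_vertices V E" "e \<in> E" "v \<in> e" "e' \<in> E" "v \<in> e'"
  shows "e = e'"
proof -
  have "card {e \<in> E. v \<in> e} = 1"
    using assms(1) by (simp add: pendant_vertices_def degree_def)
  then obtain e0 where "{e \<in> E. v \<in> e} = {e0}"
    by (rule card_1_singletonE)
  moreover have "e \<in> {e \<in> E. v \<in> e}" "e' \<in> {e \<in> E. v \<in> e}"
    using assms by simp_all
  ultimately show ?thesis
    by simp
qed

text \<open>The ends of such an edge have no other neighbours, so walks starting at one of them never
  leave the pair; by connectedness the pair is the whole vertex set.\<close>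

lemma no_edge_joins_pendants:
  assumes "simple_graph V E" "connected_graph V E" "card V \<ge> 3"
    and "e \<in> E" "u \<in> e" "v \<in> e" "u \<in> pendant_vertices V E" "v \<in> pendant_vertices V E"
  shows "u = v"
proof (rule ccontr)
  assume "u \<noteq> v"
  obtain x y where "e = {x, y}"
    using simple_graph_edgeE[OF assms(1,4)] .
  then have e: "e = {u, v}"
    using \<open>u \<noteq> v\<close> assms(5,6) by auto
  have closed: "y \<in> e" if "x \<in> e" "{x, y} \<in> E" for x y
  proof -
    have "x \<in> pendant_vertices V E"
      using that(1) e assms(7,8) by auto
    then have "e = {x, y}"
      using pendant_edge_unique[of x V E e "{x, y}"] that assms(4) by blast
    then show ?thesis
      by simp
  qed
  have "V \<subseteq> e"
  proof
    fix w assume "w \<in> V"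
    moreover have "u \<in> V"
      using assms(7) by (simp add: pendant_vertices_def)
    ultimately have "(u, w) \<in> {(x, y). {x, y} \<in> E}\<^sup>*"
      using assms(2) by (simp add: connected_graph_def)
    then show "w \<in> e"
      by induction (use assms(5) closed in auto)
  qed
  then have "card V \<le> card e"
    using e by (intro card_mono) auto
  then show False
    using assms(3) e \<open>u \<noteq> v\<close> by simp
qed

text \<open>The sets of edges at the various pendant vertices are singletons and pairwise disjoint.\<close>

lemma card_pendant_edges:
  assumes "simple_graph V E" "connected_graph V E" "card V \<ge> 3"
  shows "card {e \<in> E. e \<inter> pendant_vertices V E \<noteq> {}} = card (pendant_vertices V E)"
proof -
  let ?P = "pendant_vertices V E"
  have "{e \<in> E. e \<inter> ?P \<noteq> {}} = (\<Union>v\<in>?P. {e \<in> E. v \<in> e})"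
    by auto
  also have "card \<dots> = (\<Sum>v\<in>?P. card {e \<in> E. v \<in> e})"
  proof (rule card_UN_disjoint)
    show "finite ?P"
      using assms(1) by (simp add: simple_graph_def pendant_vertices_def)
    show "\<forall>v\<in>?P. finite {e \<in> E. v \<in> e}"
      using simple_graph_finite_edges[OF assms(1)] by simp
    show "\<forall>u\<in>?P. \<forall>v\<in>?P. u \<noteq> v \<longrightarrow> {e \<in> E. u \<in> e} \<inter> {e \<in> E. v \<in> e} = {}"
      using no_edge_joins_pendants[OF assms] by blast
  qed
  also have "\<dots> = card ?P"
    by (simp add: pendant_vertices_def degree_def)
  finally show ?thesis .
qed

section \<open>The bound and its equality case\<close>

lemma sum_mono_eq_iff:
  fixes f g :: "'b \<Rightarrow> real"
  assumes "finite A" "\<And>x. x \<in> A \<Longrightarrow> f x \<le> g x"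
  shows "sum f A = sum g A \<longleftrightarrow> (\<forall>x\<in>A. f x = g x)"
proof -
  have "sum f A = sum g A \<longleftrightarrow> (\<Sum>x\<in>A. g x - f x) = 0"
    by (auto simp: sum_subtractf)
  also have "\<dots> \<longleftrightarrow> (\<forall>x\<in>A. g x - f x = 0)"
    using assms by (intro sum_nonneg_eq_0_iff) auto
  finally show ?thesis
    by auto
qed

theorem theorem2:
  fixes V :: "'a set" and E :: "'a set set" and m p \<Delta> \<delta>\<^sub>1 :: nat
  assumes "simple_graph V E" and "connected_graph V E" and "card V \<ge> 3"
    and "m = card E"
    and "\<Delta> = max_degree V E"
    and "p = card (pendant_vertices V E)"
    and "\<delta>\<^sub>1 = min_nonpendant_degree V E"
  shows "DSO E \<le> real p * (sqrt ((real \<Delta>)\<^sup>2 + 1) / (real \<Delta> + 1))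
            + (real m - real p) * (sqrt ((real \<Delta>)\<^sup>2 + (real \<delta>\<^sub>1)\<^sup>2) / (real \<Delta> + real \<delta>\<^sub>1))
    \<and> (DSO E = real p * (sqrt ((real \<Delta>)\<^sup>2 + 1) / (real \<Delta> + 1))
            + (real m - real p) * (sqrt ((real \<Delta>)\<^sup>2 + (real \<delta>\<^sub>1)\<^sup>2) / (real \<Delta> + real \<delta>\<^sub>1))
        \<longleftrightarrow>
        (\<forall>u v. {u, v} \<in> E \<and> u \<in> pendant_vertices V E \<longrightarrow> degree E v = \<Delta>) \<and>
        (\<forall>u v. {u, v} \<in> E \<and> u \<notin> pendant_vertices V E \<and> v \<notin> pendant_vertices V E \<longrightarrow>
            (degree E u = \<Delta> \<and> degree E v = \<delta>\<^sub>1) \<or> (degree E u = \<delta>\<^sub>1 \<and> degree E v = \<Delta>)))"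
proof -
  let ?P = "pendant_vertices V E"
  let ?d = "\<lambda>v. real (degree E v)"
  define A where "A = sombor_ratio (real \<Delta>) 1"
  define B where "B = sombor_ratio (real \<Delta>) (real \<delta>\<^sub>1)"
  define w where "w = (\<lambda>e. sqrt (\<Sum>v\<in>e. (?d v)\<^sup>2) / (\<Sum>v\<in>e. ?d v))"
  define b where "b = (\<lambda>e. if e \<inter> ?P \<noteq> {} then A else B)"
  note graph = assms(1)
  have finE: "finite E"
    using simple_graph_finite_edges[OF graph] .

  have w: "w {u, v} = sombor_ratio (?d u) (?d v)" if "u \<noteq> v" for u v
    unfolding w_def sombor_ratio_def using that by (rule DSO_summand)

  have range: "1 \<le> ?d u" "?d u \<le> real \<Delta>" if "{u, v} \<in> E" for u v
    using degree_pos[OF graph that, of u] simple_graph_edgeD(1)[OF graph that]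
      degree_le_max_degree[OF graph, of u] assms(5) by auto

  have pendant: "w {u, v} \<le> b {u, v}" "w {u, v} = b {u, v} \<longleftrightarrow> degree E v = \<Delta>"
    if uv: "{u, v} \<in> E" and u: "u \<in> ?P" for u v
  proof -
    have vu: "{v, u} \<in> E"
      using uv by (simp add: insert_commute)
    have "?d u = 1" "b {u, v} = A"
      using u by (simp_all add: pendant_vertices_def b_def)
    moreover have "w {u, v} = sombor_ratio (?d u) (?d v)"
      using w simple_graph_edgeD(3)[OF graph uv] .
    ultimately show "w {u, v} \<le> b {u, v}" "w {u, v} = b {u, v} \<longleftrightarrow> degree E v = \<Delta>"
      using range[OF uv] range[OF vu]
        sombor_ratio_le[of 1 1 "real \<Delta>" "?d v"] sombor_ratio_eq_iff[of 1 1 "real \<Delta>" "?d v"]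
      \<comment> \<open>The other corner, \<open>1 = \<Delta>\<close> with \<open>?d v = 1\<close>, also has \<open>?d v = \<Delta>\<close>.\<close>
      by (auto simp: A_def)
  qed

  have nonpendant: "w {u, v} \<le> b {u, v}"
      "w {u, v} = b {u, v} \<longleftrightarrow>
        (degree E u = \<Delta> \<and> degree E v = \<delta>\<^sub>1) \<or> (degree E u = \<delta>\<^sub>1 \<and> degree E v = \<Delta>)"
    if uv: "{u, v} \<in> E" and "u \<notin> ?P" "v \<notin> ?P" for u v
  proof -
    have vu: "{v, u} \<in> E"
      using uv by (simp add: insert_commute)
    have "real \<delta>\<^sub>1 \<le> ?d u" "real \<delta>\<^sub>1 \<le> ?d v"
      using that simple_graph_edgeD[OF graph uv] min_nonpendant_degree_le[OF graph] assms(7)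
      by auto
    moreover have "w {u, v} = sombor_ratio (?d u) (?d v)"
      using w simple_graph_edgeD(3)[OF graph uv] .
    moreover have "b {u, v} = B"
      using that by (simp add: b_def)
    ultimately show "w {u, v} \<le> b {u, v}"
      "w {u, v} = b {u, v} \<longleftrightarrow>
        (degree E u = \<Delta> \<and> degree E v = \<delta>\<^sub>1) \<or> (degree E u = \<delta>\<^sub>1 \<and> degree E v = \<Delta>)"
      using range[OF uv] range[OF vu]
        sombor_ratio_le[of "real \<delta>\<^sub>1" "?d u" "real \<Delta>" "?d v"]
        sombor_ratio_eq_iff[of "real \<delta>\<^sub>1" "?d u" "real \<Delta>" "?d v"]
      by (auto simp: B_def)
  qed

  have le: "w e \<le> b e" if "e \<in> E" for e
  proof -
    obtain u v where e: "e = {u, v}"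
      using simple_graph_edgeE[OF graph \<open>e \<in> E\<close>] .
    consider "u \<in> ?P" | "v \<in> ?P" | "u \<notin> ?P" "v \<notin> ?P" by blast
    then show ?thesis
      using pendant(1)[of u v] pendant(1)[of v u] nonpendant(1)[of u v] that
      by cases (simp_all add: e insert_commute)
  qed

  have eq: "(\<forall>e\<in>E. w e = b e) \<longleftrightarrow>
      (\<forall>u v. {u, v} \<in> E \<and> u \<in> ?P \<longrightarrow> degree E v = \<Delta>) \<and>
      (\<forall>u v. {u, v} \<in> E \<and> u \<notin> ?P \<and> v \<notin> ?P \<longrightarrow>
          (degree E u = \<Delta> \<and> degree E v = \<delta>\<^sub>1) \<or> (degree E u = \<delta>\<^sub>1 \<and> degree E v = \<Delta>))"
    (is "?L \<longleftrightarrow> ?R")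
  proof
    assume ?L
    then show ?R
      using pendant(2) nonpendant(2) by blast
  next
    assume R: ?R
    show ?L
    proof
      fix e assume "e \<in> E"
      obtain u v where e: "e = {u, v}"
        using simple_graph_edgeE[OF graph \<open>e \<in> E\<close>] .
      have uv: "{u, v} \<in> E" "{v, u} \<in> E"
        using \<open>e \<in> E\<close> e by (simp_all add: insert_commute)
      consider "u \<in> ?P" | "v \<in> ?P" | "u \<notin> ?P" "v \<notin> ?P" by blast
      then show "w e = b e"
      proof cases
        case 1
        then show ?thesis using R uv(1) pendant(2)[OF uv(1)] e by blast
      next
        case 2
        then have "w {v, u} = b {v, u}" using R uv(2) pendant(2)[OF uv(2)] by blast
        then show ?thesis by (simp add: e insert_commute)
      next
        case 3
        then show ?thesis using R uv(1) nonpendant(2)[OF uv(1)] e by blast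
      qed
    qed
  qed

  have "sum b E = (\<Sum>e\<in>{e \<in> E. e \<inter> ?P \<noteq> {}}. A) + (\<Sum>e\<in>E - {e \<in> E. e \<inter> ?P \<noteq> {}}. B)"
  proof -
    have "E \<inter> {e. e \<inter> ?P \<noteq> {}} = {e \<in> E. e \<inter> ?P \<noteq> {}}"
      "E \<inter> - {e. e \<inter> ?P \<noteq> {}} = E - {e \<in> E. e \<inter> ?P \<noteq> {}}"
      by blast+
    then show ?thesis
      unfolding b_def sum.If_cases[OF finE] by (simp only:)
  qed
  also have "\<dots> = real p * A + (real m - real p) * B"
  proof -
    have "card {e \<in> E. e \<inter> ?P \<noteq> {}} = p"
      using card_pendant_edges[OF assms(1-3)] assms(6) by simp
    moreover from this have "p \<le> m"
      using card_mono[OF finE, of "{e \<in> E. e \<inter> ?P \<noteq> {}}"] assms(4) by auto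
    ultimately show ?thesis
      using finE assms(4) by (simp add: card_Diff_subset of_nat_diff)
  qed
  finally have sum_b: "sum b E = real p * A + (real m - real p) * B" .

  have "DSO E = sum w E"
    by (simp add: DSO_def w_def)
  moreover have "sum w E \<le> sum b E"
    using le by (rule sum_mono)
  moreover have "sum w E = sum b E \<longleftrightarrow> (\<forall>e\<in>E. w e = b e)"
    using finE le by (rule sum_mono_eq_iff)
  ultimately have "DSO E \<le> real p * A + (real m - real p) * B \<and>
      (DSO E = real p * A + (real m - real p) * B \<longleftrightarrow> (\<forall>e\<in>E. w e = b e))"
    by (simp add: sum_b)
  then show ?thesis
    unfolding eq by (simp only: A_def B_def sombor_ratio_def one_power2)
qed

end
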